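(* Let $G$ and $H$ be connected graphs with $\kappa(G)\ge 2$. (i) If $\mathrm{gon}(G)=2$, $\frac{|V(H)|}{\lambda(H)}\le\frac12|V(G)|$, and $|V(H)|\le \frac12|V(G)|\lambda(H)+(\delta(G)-\lambda(H))$, then $\mathrm{sn}(G\square H)=\mathrm{gon}(G\square H)=2|V(H)|$. (ii) If $\lambda(H)=\mathrm{gon}(H)$, $\frac{2|V(H)|}{\lambda(H)}\ge |V(G)|$, and $\lambda(H)\le\delta(G)$, then $\mathrm{sn}(G\square H)=\mathrm{gon}(G\square H)=|V(G)|\lambda(H)$.
   Context: Graphs are finite, multiple edges allowed, no loops. $\kappa$ is vertex-connectivity, $\lambda$ edge-connectivity (edges with multiplicity), $\delta(G)$ minimum valence. $G\square H$ is the Cartesian product (vertex set $V(G)\times V(H)$; $(u_1,v_1),(u_2,v_2)$ joined by $e$ edges iff $u_1=u_2$ and $v_1,v_2$ joined by $e$ edges in $H$, or $v_1=v_2$ and $u_1,u_2$ joined by $e$ edges in $G$). Scramble number $\mathrm{sn}$: a scramble is a finite collection of nonempty vertex sets (eggs) each inducing a connected subgraph; its order is $\min(h,e)$ where $h$ is the minimum size of a vertex set meeting every egg and $e$ is the minimum of $|E(A,A^C)|$ over $A\subseteq V$ containing some egg whose complement contains some egg ($+\infty$ if none); $\mathrm{sn}$ is the maximum order. Gonality: a divisor is an integer combination of vertices; firing a vertex $w$ removes $\mathrm{val}(w)$ chips from $w$ and gives each other vertex one chip per edge to $w$; divisors are equivalent if related by firings; $D$ has positive rank if $D-(v)$ is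 equivalent to an effective divisor for every vertex $v$; $\mathrm{gon}$ is the minimum degree of a positive rank divisor. *)

theory Defs
  imports Complex_Main "HOL-Library.Extended_Nat"
begin

text \<open>
  A multigraph is a vertex set together with the number \<open>emult G u v\<close> of edges joining
  \<open>u\<close> and \<open>v\<close>.
\<close>

record 'a mgraph =
  verts :: "'a set"
  emult :: "'a \<Rightarrow> 'a \<Rightarrow> nat"

definition multigraph :: "'a mgraph \<Rightarrow> bool" where
  "multigraph G \<longleftrightarrow>
     finite (verts G) \<and> verts G \<noteq> {} \<and>
     (\<forall>u v. emult G u v = emult G v u) \<and>
     (\<forall>v. emult G v v = 0) \<and>
     (\<forall>u v. emult G u v > 0 \<longrightarrow> u \<in> verts G \<and> v \<in> verts G)"

definition induced :: "'a mgraph \<Rightarrow> 'a set \<Rightarrow> 'a mgraph" where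
  "induced G S =
     \<lparr>verts = S, emult = (\<lambda>u v. if u \<in> S \<and> v \<in> S then emult G u v else 0)\<rparr>"

definition graph_connected :: "'a mgraph \<Rightarrow> bool" where
  "graph_connected G \<longleftrightarrow>
     (\<forall>u\<in>verts G. \<forall>v\<in>verts G. (\<lambda>x y. emult G x y > 0)\<^sup>*\<^sup>* u v)"

definition cart_prod :: "'a mgraph \<Rightarrow> 'b mgraph \<Rightarrow> ('a \<times> 'b) mgraph"  (infixl "\<box>" 70) where
  "G \<box> H =
     \<lparr>verts = verts G \<times> verts H,
      emult = (\<lambda>(u1, v1) (u2, v2).
        if u1 = u2 \<and> u1 \<in> verts G then emult H v1 v2
        else if v1 = v2 \<and> v1 \<in> verts H then emult G u1 u2
        else 0)\<rparr>"

lemma multigraph_cart_prod: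
  assumes "multigraph G" and "multigraph H"
  shows "multigraph (G \<box> H)"
  using assms unfolding multigraph_def cart_prod_def
  by (auto split: if_splits)

definition valence :: "'a mgraph \<Rightarrow> 'a \<Rightarrow> nat" where
  "valence G v = (\<Sum>u\<in>verts G. emult G v u)"

definition min_valence :: "'a mgraph \<Rightarrow> nat" where
  "min_valence G = Min (valence G ` verts G)"

text \<open>
  Vertex-connectivity is the least number of vertices whose removal leaves a disconnected graph
  or a single vertex, so that complete graphs on \<open>n\<close> vertices (possibly with
  parallel edges) have vertex-connectivity \<open>n - 1\<close>.
\<close>

definition vertex_connectivity :: "'a mgraph \<Rightarrow> nat" where
  "vertex_connectivity G =
     (LEAST k. \<exists>S\<subseteq>verts G. card S = k \<and>
        (\<not> graph_connected (induced G (verts G - S)) \<or> card (verts G - S) = 1))"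

text \<open>
  A set of edges to be deleted is given by its multiplicities \<open>F u v\<close>; every edge is counted
  twice in the double sum over ordered pairs of vertices.
\<close>

definition edge_subset :: "'a mgraph \<Rightarrow> ('a \<Rightarrow> 'a \<Rightarrow> nat) \<Rightarrow> bool" where
  "edge_subset G F \<longleftrightarrow> (\<forall>u v. F u v = F v u \<and> F u v \<le> emult G u v)"

definition num_edges :: "'a mgraph \<Rightarrow> ('a \<Rightarrow> 'a \<Rightarrow> nat) \<Rightarrow> nat" where
  "num_edges G F = (\<Sum>u\<in>verts G. \<Sum>v\<in>verts G. F u v) div 2"

definition delete_edges :: "'a mgraph \<Rightarrow> ('a \<Rightarrow> 'a \<Rightarrow> nat) \<Rightarrow> 'a mgraph" where
  "delete_edges G F = \<lparr>verts = verts G, emult = (\<lambda>u v. emult G u v - F u v)\<rparr>"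

text \<open>
  A one-vertex graph cannot be disconnected by deleting edges; its edge-connectivity is \<open>0\<close> by
  convention.
\<close>

definition edge_connectivity :: "'a mgraph \<Rightarrow> nat" where
  "edge_connectivity G =
     (if card (verts G) = 1 then 0
      else LEAST k. \<exists>F. edge_subset G F \<and> num_edges G F = k \<and>
                        \<not> graph_connected (delete_edges G F))"

definition cut_size :: "'a mgraph \<Rightarrow> 'a set \<Rightarrow> nat" where
  "cut_size G A = (\<Sum>u\<in>A. \<Sum>v\<in>verts G - A. emult G u v)"

definition scramble :: "'a mgraph \<Rightarrow> 'a set set \<Rightarrow> bool" where
  "scramble G S \<longleftrightarrow>
     (\<forall>E\<in>S. E \<subseteq> verts G \<and> E \<noteq> {} \<and> graph_connected (induced G E))"

definition hitting_number :: "'a mgraph \<Rightarrow> 'a set set \<Rightarrow> nat" where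
  "hitting_number G S = (LEAST k. \<exists>T\<subseteq>verts G. card T = k \<and> (\<forall>E\<in>S. T \<inter> E \<noteq> {}))"

text \<open>The infimum of the empty set in \<^typ>\<open>enat\<close> is \<open>\<infinity>\<close>.\<close>

definition egg_cut_number :: "'a mgraph \<Rightarrow> 'a set set \<Rightarrow> enat" where
  "egg_cut_number G S =
     (INF A \<in> {A. A \<subseteq> verts G \<and> (\<exists>E\<in>S. E \<subseteq> A) \<and> (\<exists>E\<in>S. E \<subseteq> verts G - A)}.
        enat (cut_size G A))"

definition scramble_order :: "'a mgraph \<Rightarrow> 'a set set \<Rightarrow> enat" where
  "scramble_order G S = min (enat (hitting_number G S)) (egg_cut_number G S)"

definition scramble_number :: "'a mgraph \<Rightarrow> enat" where
  "scramble_number G = Max (scramble_order G ` {S. scramble G S})"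

definition divisors :: "'a mgraph \<Rightarrow> ('a \<Rightarrow> int) set" where
  "divisors G = {D. \<forall>v. v \<notin> verts G \<longrightarrow> D v = 0}"

definition degree :: "'a mgraph \<Rightarrow> ('a \<Rightarrow> int) \<Rightarrow> int" where
  "degree G D = (\<Sum>v\<in>verts G. D v)"

definition effective :: "'a mgraph \<Rightarrow> ('a \<Rightarrow> int) \<Rightarrow> bool" where
  "effective G D \<longleftrightarrow> (\<forall>v\<in>verts G. D v \<ge> 0)"

definition fire :: "'a mgraph \<Rightarrow> 'a \<Rightarrow> ('a \<Rightarrow> int) \<Rightarrow> 'a \<Rightarrow> int" where
  "fire G w D = (\<lambda>v. if v = w then D v - int (valence G w) else D v + int (emult G w v))"

definition div_equiv :: "'a mgraph \<Rightarrow> ('a \<Rightarrow> int) \<Rightarrow> ('a \<Rightarrow> int) \<Rightarrow> bool" where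
  "div_equiv G = equivclp (\<lambda>D D'. \<exists>w\<in>verts G. D' = fire G w D)"

definition positive_rank :: "'a mgraph \<Rightarrow> ('a \<Rightarrow> int) \<Rightarrow> bool" where
  "positive_rank G D \<longleftrightarrow>
     (\<forall>v\<in>verts G. \<exists>D'. div_equiv G (D(v := D v - 1)) D' \<and> effective G D')"

text \<open>
  Firing preserves the degree, so on a nonempty graph a divisor of positive rank has degree at
  least \<open>1\<close>; hence it is enough to minimise over natural numbers.
\<close>

definition gonality :: "'a mgraph \<Rightarrow> nat" where
  "gonality G =
     (LEAST k. \<exists>D\<in>divisors G. positive_rank G D \<and> degree G D = int k)"

end

theory Submission
  imports Defs
begin

text \<open>
  The upper bound places a positive rank divisor of one factor on every copy of that factor.
  The lower bound comes from the inequality of scramble number and gonality, applied to the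
  scramble whose eggs are the copies of \<open>G\<close> with one vertex removed; they are connected because
  \<open>\<kappa>(G) \<ge> 2\<close>. A hitting set needs two vertices in every copy of \<open>G\<close>. An egg-cut splits every copy
  of \<open>H\<close>, except possibly those over the two removed vertices, and each of these, if not split,
  forces a whole vertex star of \<open>G\<close> to be cut.
\<close>

section \<open>Firing scripts\<close>

text \<open>Write n = |V(G)|, l = \<open>edge_connectivity H\<close>, d =
  \<open>min_valence G\<close>. At most two copies of H escape being split, and each escape is paid
  for by a star of G, so an egg-cut has at least the smallest of n*l, (n-1)*l + d and (n-2)*l + 2*d
  edges. The middle value is the mean of the outer two, hence a number k is a lower bound as soon as
  k \<le> n*l and k + 2*l \<le> n*l + 2*d; the hitting sets add k \<le> 2*|V(H)|. For k = 2*|V(H)|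
  these are the two inequalities assumed in (i), for k = n*l they reduce to the two assumed in (ii).
  So one lower bound serves both claims, and only the factor that supplies the divisor changes. For
  the comparison with gonality, a sequence of firings is recorded by a script f that counts, with
  sign, how often each vertex is fired. The result is D minus the Laplacian of f, which does not
  depend on the order, so the same move can be rearranged into firings of the level sets of
  f.\<close>

definition fire_script :: "'a mgraph \<Rightarrow> ('a \<Rightarrow> int) \<Rightarrow> ('a \<Rightarrow> int) \<Rightarrow> 'a \<Rightarrow> int" where
  "fire_script G f D = (\<lambda>v. D v + (\<Sum>w\<in>verts G. int (emult G v w) * (f w - f v)))"

lemma fire_script_add:
  "fire_script G f (fire_script G g D) = fire_script G (\<lambda>v. f v + g v) D"
  by (rule ext) (simp add: fire_script_def algebra_simps sum.distrib sum_subtractf)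

lemma fire_script_zero [simp]: "fire_script G (\<lambda>v. 0) D = D"
  by (simp add: fire_script_def)

lemma fire_script_uminus:
  "fire_script G (\<lambda>v. - f v) (fire_script G f D) = D"
  by (simp add: fire_script_add)

text \<open>Constants lie in the kernel of the Laplacian. This allows a script to be shifted to
  nonnegative values, and the firing of a set to be undone by firing its complement.\<close>

lemma fire_script_add_const:
  "fire_script G (\<lambda>v. f v + c) D = fire_script G f D"
  by (simp add: fire_script_def)

lemma fire_script_cong:
  assumes "multigraph G" and "\<And>v. v \<in> verts G \<Longrightarrow> f v = g v"
  shows "fire_script G f D = fire_script G g D"
proof
  fix v
  have "(\<Sum>w\<in>verts G. int (emult G v w) * (f w - f v)) =
        (\<Sum>w\<in>verts G. int (emult G v w) * (g w - g v))"
  proof (rule sum.cong)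
    fix w assume "w \<in> verts G"
    with assms show "int (emult G v w) * (f w - f v) = int (emult G v w) * (g w - g v)"
      unfolding multigraph_def by (cases "v \<in> verts G") auto
  qed simp
  then show "fire_script G f D v = fire_script G g D v"
    by (simp add: fire_script_def)
qed

lemma fire_script_fun_upd_diff:
  "fire_script G f (D(v := D v - c)) = (fire_script G f D)(v := fire_script G f D v - c)"
  by (rule ext) (simp add: fire_script_def)

lemma fire_eq_fire_script:
  assumes "multigraph G" and "w \<in> verts G"
  shows "fire G w D = fire_script G (\<lambda>v. if v = w then 1 else 0) D"
proof
  fix v
  have fin: "finite (verts G)" and sym: "emult G w v = emult G v w" and irr: "emult G v v = 0"
    using assms unfolding multigraph_def by auto
  show "fire G w D v = fire_script G (\<lambda>v. if v = w then 1 else 0) D v"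
  proof (cases "v = w")
    case True
    have "(\<Sum>x\<in>verts G. int (emult G w x) * ((if x = w then 1 else 0) - 1)) =
          (\<Sum>x\<in>verts G. - int (emult G w x))"
      by (rule sum.cong) (use irr True in auto)
    then show ?thesis
      using True by (simp add: fire_def fire_script_def valence_def sum_negf)
  next
    case False
    have "(\<Sum>x\<in>verts G. int (emult G v x) * (if x = w then 1 else 0)) =
          (\<Sum>x\<in>verts G. if x = w then int (emult G v w) else 0)"
      by (rule sum.cong) auto
    then show ?thesis
      using False fin assms(2) sym by (simp add: fire_def fire_script_def)
  qed
qed

lemma div_equiv_imp_fire_script:
  assumes "multigraph G" and "div_equiv G D D'"
  shows "\<exists>f. D' = fire_script G f D"
  using assms(2) unfolding div_equiv_def
proof (induction rule: equivclp_induct)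
  case base
  show ?case by (metis fire_script_zero)
next
  case (step D1 D2)
  then obtain f where f: "D1 = fire_script G f D" by blast
  from step(2) consider w where "w \<in> verts G" "D2 = fire G w D1"
    | w where "w \<in> verts G" "D1 = fire G w D2" by blast
  then show ?case
  proof cases
    case 1
    then show ?thesis
      using f fire_eq_fire_script[OF assms(1)] fire_script_add by metis
  next
    case 2
    then have "D2 = fire_script G (\<lambda>v. - (if v = w then 1 else 0)) D1"
      using fire_eq_fire_script[OF assms(1)] fire_script_uminus by metis
    then show ?thesis
      using f fire_script_add by metis
  qed
qed

lemma div_equiv_fire_script_single:
  assumes "multigraph G" and "w \<in> verts G"
  shows "div_equiv G D (fire_script G (\<lambda>v. if v = w then c else 0) D)"
proof -
  have trans: "div_equiv G D1 D2 \<Longrightarrow> div_equiv G D2 D3 \<Longrightarrow> div_equiv G D1 D3" for D1 D2 D3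
    unfolding div_equiv_def by (rule equivclp_trans)
  have nat: "div_equiv G D (fire_script G (\<lambda>v. if v = w then int n else 0) D)" for n D
  proof (induction n)
    case 0
    have "(\<lambda>v. if v = w then int 0 else 0) = (\<lambda>v. 0)" by auto
    then show ?case by (simp only: fire_script_zero div_equiv_def equivclp_refl)
  next
    case (Suc n)
    let ?D = "fire_script G (\<lambda>v. if v = w then int n else 0) D"
    have "fire G w ?D = fire_script G (\<lambda>v. if v = w then int (Suc n) else 0) D"
      unfolding fire_eq_fire_script[OF assms] fire_script_add
      by (rule arg_cong2[where f = "fire_script G"]) auto
    moreover have "div_equiv G ?D (fire G w ?D)"
      unfolding div_equiv_def using assms(2) by (intro r_into_equivclp) blast
    ultimately show ?case
      using trans[OF Suc] by simp
  qed
  show ?thesis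
  proof (cases c rule: int_cases2)
    case (nonneg n)
    show ?thesis unfolding nonneg by (rule nat)
  next
    \<comment> \<open>Here c = -n, so firing \<open>w\<close> n more times leads from the target
      back to \<open>D\<close>; symmetry of the equivalence reverses this.\<close>
    case (nonpos n)
    let ?D = "fire_script G (\<lambda>v. if v = w then c else 0) D"
    have "fire_script G (\<lambda>v. if v = w then int n else 0) ?D = fire_script G (\<lambda>v. 0) D"
      unfolding fire_script_add by (rule arg_cong2[where f = "fire_script G"]) (use nonpos in auto)
    then have "div_equiv G ?D D"
      using nat[of ?D n] by simp
    then show ?thesis
      unfolding div_equiv_def by (rule equivclp_sym)
  qed
qed

lemma div_equiv_fire_script:
  assumes "multigraph G"
  shows "div_equiv G D (fire_script G f D)"
proof -
  have fin: "finite (verts G)"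
    using assms by (simp add: multigraph_def)
  \<comment> \<open>The script is carried out one vertex at a time: \<open>X\<close> is the set of
    vertices already treated.\<close>
  have "div_equiv G D (fire_script G (\<lambda>v. if v \<in> X then f v else 0) D)" if "X \<subseteq> verts G" for X
    using finite_subset[OF that fin] that
  proof (induction X rule: finite_induct)
    case empty
    then show ?case by (simp add: div_equiv_def)
  next
    case (insert w X)
    let ?D = "fire_script G (\<lambda>v. if v \<in> X then f v else 0) D"
    have "fire_script G (\<lambda>v. if v = w then f w else 0) ?D =
          fire_script G (\<lambda>v. if v \<in> insert w X then f v else 0) D"
      unfolding fire_script_add
      by (rule arg_cong2[where f = "fire_script G"]) (use insert.hyps in auto)
    moreover have "div_equiv G ?D (fire_script G (\<lambda>v. if v = w then f w else 0) ?D)"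
      using insert.prems by (intro div_equiv_fire_script_single assms) auto
    ultimately show ?case
      using insert by (auto simp: div_equiv_def intro: equivclp_trans)
  qed
  from this[of "verts G"] show ?thesis
    using fire_script_cong[OF assms, of "\<lambda>v. if v \<in> verts G then f v else 0" f] by simp
qed

text \<open>Removing a chip from v commutes with firing, so the debt at v can be settled exactly
  when some effective divisor equivalent to \<open>D\<close> has a chip on v.\<close>

lemma positive_rank_iff_fire_script:
  assumes "multigraph G"
  shows "positive_rank G D \<longleftrightarrow>
    (\<forall>v\<in>verts G. \<exists>f. effective G (fire_script G f D) \<and> fire_script G f D v > 0)"
proof -
  have "(\<exists>D'. div_equiv G (D(v := D v - 1)) D' \<and> effective G D') \<longleftrightarrow>
        (\<exists>f. effective G (fire_script G f D) \<and> fire_script G f D v > 0)"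
    if "v \<in> verts G" for v
  proof -
    have "(\<exists>D'. div_equiv G (D(v := D v - 1)) D' \<and> effective G D') \<longleftrightarrow>
          (\<exists>f. effective G (fire_script G f (D(v := D v - 1))))"
      using div_equiv_imp_fire_script[OF assms] div_equiv_fire_script[OF assms] by metis
    also have "\<dots> \<longleftrightarrow> (\<exists>f. effective G (fire_script G f D) \<and> fire_script G f D v > 0)"
    proof -
      have "effective G (E(v := E v - 1)) \<longleftrightarrow> effective G E \<and> E v > 0" for E
      proof
        assume "effective G (E(v := E v - 1))"
        then have "0 \<le> (E(v := E v - 1)) w" if "w \<in> verts G" for w
          using that by (simp add: effective_def)
        from this[OF \<open>v \<in> verts G\<close>] this show "effective G E \<and> E v > 0"
          by (fastforce simp: effective_def split: if_splits)
      qed (auto simp: effective_def)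
      then show ?thesis
        unfolding fire_script_fun_upd_diff by blast
    qed
    finally show ?thesis .
  qed
  then show ?thesis
    unfolding positive_rank_def by blast
qed

lemma degree_fire_script:
  assumes "multigraph G"
  shows "degree G (fire_script G f D) = degree G D"
proof -
  have sym: "emult G v w = emult G w v" for v w
    using assms by (simp add: multigraph_def)
  have "(\<Sum>v\<in>verts G. \<Sum>w\<in>verts G. int (emult G v w) * f w) =
        (\<Sum>v\<in>verts G. \<Sum>w\<in>verts G. int (emult G v w) * f v)"
    by (subst sum.swap) (simp add: sym)
  then show ?thesis
    by (simp add: degree_def fire_script_def sum.distrib right_diff_distrib sum_subtractf)
qed

section \<open>Scramble number and gonality\<close>

text \<open>A vertex of U loses one chip along each of its edges leaving U and receives nothing, so
  to end without debt it must own that many chips beforehand.\<close>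

lemma fire_set_cut_size_le:
  assumes "multigraph G" and "U \<subseteq> verts G" and "effective G D"
    and "effective G (fire_script G (\<lambda>v. of_bool (v \<in> U)) D)"
  shows "int (cut_size G U) \<le> degree G D"
proof -
  have fin: "finite (verts G)"
    using assms(1) by (simp add: multigraph_def)
  have "(\<Sum>v\<in>verts G - U. int (emult G u v)) \<le> D u" if "u \<in> U" for u
  proof -
    have "(\<Sum>w\<in>verts G. int (emult G u w) * (of_bool (w \<in> U) - of_bool (u \<in> U))) =
          (\<Sum>w\<in>verts G. if w \<in> verts G - U then - int (emult G u w) else 0)"
      by (rule sum.cong) (use that in auto)
    also have "\<dots> = - (\<Sum>w\<in>verts G - U. int (emult G u w))"
      using fin by (subst sum.inter_filter[symmetric]) (auto simp: sum_negf intro: sum.cong)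
    finally show ?thesis
      using assms(2,4) that unfolding effective_def fire_script_def by fastforce
  qed
  then have "int (cut_size G U) \<le> (\<Sum>u\<in>U. D u)"
    by (simp add: cut_size_def sum_mono)
  also have "\<dots> \<le> degree G D"
    unfolding degree_def using fin assms(2,3) by (intro sum_mono2) (auto simp: effective_def)
  finally show ?thesis .
qed

section \<open>Eggs that gain or lose all their chips when a set is fired\<close>

lemma connected_induced_crossing_edge:
  assumes "graph_connected (induced G E)" and "x \<in> E" "x \<in> U" and "y \<in> E" "y \<notin> U"
  shows "\<exists>a\<in>E \<inter> U. \<exists>b\<in>E - U. emult G a b > 0"
proof (rule ccontr)
  assume no: "\<not> ?thesis"
  have "(\<lambda>a b. emult (induced G E) a b > 0)\<^sup>*\<^sup>* x y"
    using assms by (auto simp: graph_connected_def induced_def)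
  then have "y \<in> U"
  proof (induction rule: rtranclp_induct)
    case base
    show ?case by (rule assms(3))
  next
    case (step a b)
    then have "a \<in> E" "b \<in> E" "emult G a b > 0"
      by (auto simp: induced_def split: if_splits)
    with step no show ?case by blast
  qed
  with assms show False by simp
qed

lemma fire_set_ge:
  assumes "v \<notin> U"
  shows "fire_script G (\<lambda>v. of_bool (v \<in> U)) D v \<ge> D v"
  using assms by (simp add: fire_script_def sum_nonneg)

text \<open>Since x loses its chips, it lies in U. If the connected egg also reached outside U, an
  edge inside it would carry a chip across, and the egg would still be met.\<close>

lemma egg_losing_chips:
  assumes "multigraph G" and "E \<subseteq> verts G" and "graph_connected (induced G E)"
    and "effective G D"
    and "x \<in> E" "D x > 0"
    and unhit: "\<And>y. y \<in> E \<Longrightarrow> fire_script G (\<lambda>v. of_bool (v \<in> U)) D y \<le> 0"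
  shows "E \<subseteq> U"
proof (rule ccontr)
  assume "\<not> E \<subseteq> U"
  then obtain y where "y \<in> E" "y \<notin> U" by blast
  moreover have "x \<in> U"
    using fire_set_ge[of x U D G] unhit[OF assms(5)] assms(6) by force
  ultimately obtain a b where ab: "a \<in> E" "a \<in> U" "b \<in> E" "b \<notin> U" "emult G a b > 0"
    using connected_induced_crossing_edge[OF assms(3,5)] by blast
  have "finite (verts G)" and sym: "emult G a b = emult G b a"
    using assms(1) by (auto simp: multigraph_def)
  \<comment> \<open>All terms of the sum at \<open>b\<close> are nonnegative because
    \<open>b\<close> is outside \<open>U\<close>, so the term of \<open>a\<close> alone bounds the
    gain of \<open>b\<close> from below.\<close>
  then have "int (emult G b a) * (of_bool (a \<in> U) - of_bool (b \<in> U)) \<le>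
        (\<Sum>w\<in>verts G. int (emult G b w) * (of_bool (w \<in> U) - of_bool (b \<in> U)))"
    using ab assms(2) by (intro member_le_sum) auto
  then have "D b < fire_script G (\<lambda>v. of_bool (v \<in> U)) D b"
    using ab sym by (simp add: fire_script_def)
  moreover have "D b \<ge> 0"
    using ab assms(2,4) by (auto simp: effective_def)
  ultimately show False
    using unhit[OF ab(3)] by simp
qed

text \<open>Time reversal of \<open>egg_losing_chips\<close>: firing the complement of U undoes the
  firing of U, since the two together fire every vertex once.\<close>

lemma egg_gaining_chips:
  assumes "multigraph G" and "E \<subseteq> verts G" and "graph_connected (induced G E)"
    and "effective G (fire_script G (\<lambda>v. of_bool (v \<in> U)) D)"
    and "x \<in> E" "fire_script G (\<lambda>v. of_bool (v \<in> U)) D x > 0"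
    and "\<And>y. y \<in> E \<Longrightarrow> D y \<le> 0"
  shows "E \<inter> U = {}"
proof -
  have "fire_script G (\<lambda>v. of_bool (v \<in> - U)) (fire_script G (\<lambda>v. of_bool (v \<in> U)) D) =
        fire_script G (\<lambda>v. 0 + 1) D"
    unfolding fire_script_add by (rule arg_cong2[where f = "fire_script G"]) auto
  also have "\<dots> = D"
    by (subst fire_script_add_const) simp
  finally have "E \<subseteq> - U"
    using assms by (intro egg_losing_chips[OF assms(1-6)]) auto
  then show ?thesis by blast
qed

text \<open>Subtraction on naturals truncates, so \<open>F v - c\<close> counts the level sets {F >
  i} with i \<ge> c that contain v. A vertex in none of them has only gained chips since the start.
  For any other vertex, truncation can only raise the differences \<open>F w - F v\<close>, so it
  holds at least as many chips as at the end.\<close>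

lemma effective_truncated_script:
  fixes F :: "'a \<Rightarrow> nat"
  assumes "multigraph G" and "effective G D" and "effective G (fire_script G (\<lambda>v. int (F v)) D)"
  shows "effective G (fire_script G (\<lambda>v. int (F v - c)) D)"
  unfolding effective_def
proof
  fix v assume v: "v \<in> verts G"
  show "0 \<le> fire_script G (\<lambda>v. int (F v - c)) D v"
  proof (cases "F v \<le> c")
    case True
    then show ?thesis
      using assms(2) v by (auto simp: effective_def fire_script_def intro!: add_nonneg_nonneg sum_nonneg)
  next
    case False
    have "fire_script G (\<lambda>v. int (F v)) D v \<le> fire_script G (\<lambda>v. int (F v - c)) D v"
      unfolding fire_script_def using False by (intro add_left_mono sum_mono mult_left_mono) auto
    then show ?thesis
      using assms(3) v by (auto simp: effective_def)
  qed
qed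

lemma fire_script_nat_ex:
  assumes "multigraph G"
  shows "\<exists>F :: 'a \<Rightarrow> nat. fire_script G (\<lambda>v. int (F v)) D = fire_script G f D"
proof -
  \<comment> \<open>Any common bound for the absolute values of f would do; adding it makes f
    nonnegative.\<close>
  define c where "c = (\<Sum>w\<in>verts G. \<bar>f w\<bar>)"
  have "finite (verts G)"
    using assms by (simp add: multigraph_def)
  then have "\<bar>f v\<bar> \<le> c" if "v \<in> verts G" for v
    using that unfolding c_def by (intro member_le_sum) auto
  then have "fire_script G (\<lambda>v. int (nat (f v + c))) D = fire_script G (\<lambda>v. f v + c) D"
    by (intro fire_script_cong assms) (force simp: abs_le_iff)
  then show ?thesis
    unfolding fire_script_add_const by (intro exI)
qed

text \<open>
  Among the effective divisors equivalent to \<open>D\<close> choose one meeting as many eggs as possible, and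
  move a chip into an egg it misses by firing an increasing chain of sets. When that egg is first
  met, some other egg has been emptied, and the set fired at this moment separates the two.
\<close>

lemma scramble_order_le_degree:
  assumes "multigraph G" and "scramble G S" and "positive_rank G D" and "degree G D = int k"
  shows "scramble_order G S \<le> enat k"
proof -
  have finV: "finite (verts G)" and neV: "verts G \<noteq> {}"
    using assms(1) by (auto simp: multigraph_def)
  have egg: "E \<subseteq> verts G" "E \<noteq> {}" "graph_connected (induced G E)" if "E \<in> S" for E
    using assms(2) that by (auto simp: scramble_def)
  have "S \<subseteq> Pow (verts G)"
    using egg by blast
  then have finS: "finite S"
    using finV finite_subset by blast
  define hit where "hit D' = {E \<in> S. \<exists>v\<in>E. D' v > 0}" for D' :: "'a \<Rightarrow> int"
  define P where "P D' \<longleftrightarrow> effective G D' \<and> (\<exists>f. D' = fire_script G f D)" for D'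
  note rank = assms(3)[unfolded positive_rank_iff_fire_script[OF assms(1)]]
  have "\<exists>D'. P D'"
    using rank neV unfolding P_def by blast
  moreover have "\<forall>D'. P D' \<longrightarrow> card (hit D') < Suc (card S)"
    using finS by (auto simp: hit_def less_Suc_eq_le intro: card_mono)
  ultimately obtain D0 where D0: "P D0" and max: "\<And>D'. P D' \<Longrightarrow> card (hit D') \<le> card (hit D0)"
    using ex_has_greatest_nat[of P _ "\<lambda>D'. card (hit D')" "Suc (card S)"] by blast
  obtain f0 where f0: "D0 = fire_script G f0 D" and eff0: "effective G D0"
    using D0 P_def by blast
  have deg: "degree G (fire_script G f D0) = int k" for f
    using degree_fire_script[OF assms(1)] f0 assms(4) by simp
  show ?thesis
  proof (cases "hit D0 = S")
    case True
    \<comment> \<open>If no egg is missed, the support of \<open>D0\<close> is a hitting set, and it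
      has at most k vertices because each of them carries a chip.\<close>
    define T where "T = {v \<in> verts G. D0 v > 0}"
    have "hitting_number G S \<le> card T"
      unfolding hitting_number_def
    proof (rule Least_le, intro exI conjI ballI)
      fix E assume "E \<in> S"
      then show "T \<inter> E \<noteq> {}"
        using True egg(1)[of E] unfolding hit_def T_def by blast
    qed (auto simp: T_def)
    moreover have "int (card T) \<le> int k"
    proof -
      have "int (card T) = (\<Sum>v\<in>T. 1)" by simp
      also have "\<dots> \<le> (\<Sum>v\<in>T. D0 v)" by (rule sum_mono) (auto simp: T_def)
      also have "\<dots> \<le> degree G D0"
        unfolding degree_def using finV eff0 by (intro sum_mono2) (auto simp: T_def effective_def)
      finally show ?thesis
        using deg[of "\<lambda>v. 0"] by simp
    qed
    ultimately show ?thesis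
      by (simp add: scramble_order_def min.coboundedI1)
  next
    case False
    then obtain E1 where E1: "E1 \<in> S" "E1 \<notin> hit D0"
      unfolding hit_def by blast
    then obtain v where v: "v \<in> E1" using egg(2) by blast
    then obtain g where g: "effective G (fire_script G g D)" "fire_script G g D v > 0"
      using rank egg(1)[OF E1(1)] by blast
    have "fire_script G (\<lambda>v. g v - f0 v) D0 = fire_script G g D"
      unfolding f0 fire_script_add by simp
    then obtain F :: "'a \<Rightarrow> nat" where F: "fire_script G (\<lambda>v. int (F v)) D0 = fire_script G g D"
      using fire_script_nat_ex[OF assms(1)] by metis
    \<comment> \<open>The index runs against time: \<open>Dc M\<close> is \<open>D0\<close>,
      \<open>Dc 0\<close> is the target, and passing from \<open>Suc c\<close> to \<open>c\<close>
      fires the level set \<open>U c\<close>. These sets grow as the index falls.\<close>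
    define Dc where "Dc c = fire_script G (\<lambda>v. int (F v - c)) D0" for c
    define M where "M = (\<Sum>w\<in>verts G. F w)"
    define U where "U c = {v \<in> verts G. F v > c}" for c
    have "Dc M = fire_script G (\<lambda>v. 0) D0"
      unfolding Dc_def
    proof (rule fire_script_cong[OF assms(1)])
      fix w assume "w \<in> verts G"
      then have "F w \<le> M"
        unfolding M_def using finV by (intro member_le_sum) auto
      then show "int (F w - M) = 0" by simp
    qed
    then have DcM: "Dc M = D0" by simp
    have Dc0: "Dc 0 = fire_script G g D"
      using F by (simp add: Dc_def)
    have eff: "effective G (Dc c)" for c
      unfolding Dc_def using F g eff0 by (intro effective_truncated_script assms(1)) auto
    have DcS: "Dc c = fire_script G (\<lambda>v. of_bool (v \<in> U c)) (Dc (Suc c))" for c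
      unfolding Dc_def fire_script_add
      by (rule fire_script_cong[OF assms(1)]) (auto simp: U_def of_nat_diff)
    have "E1 \<in> hit (Dc 0)"
      using E1 v g Dc0 by (auto simp: hit_def)
    moreover have "E1 \<notin> hit (Dc M)"
      using E1 DcM by simp
    \<comment> \<open>\<open>E1\<close> is missed at stage \<open>Suc c\<close> and met at stage
      \<open>c\<close> and at every smaller index. The subtraction does not truncate, because
      \<open>E1\<close> is met at stage 0.\<close>
    define c where "c = (LEAST c. E1 \<notin> hit (Dc c)) - 1"
    have "(LEAST c. E1 \<notin> hit (Dc c)) \<le> M" and L: "E1 \<notin> hit (Dc (LEAST c. E1 \<notin> hit (Dc c)))"
      using \<open>E1 \<notin> hit (Dc M)\<close> by (rule Least_le, rule LeastI)
    moreover from L \<open>E1 \<in> hit (Dc 0)\<close> have "(LEAST c. E1 \<notin> hit (Dc c)) \<noteq> 0"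
      by (metis (no_types))
    ultimately have cS: "Suc c \<le> M" "E1 \<notin> hit (Dc (Suc c))" and "E1 \<in> hit (Dc c)"
      using not_less_Least[of c "\<lambda>c. E1 \<notin> hit (Dc c)"] by (auto simp: c_def)
    have E1U: "E1 \<inter> U c = {}"
    proof -
      obtain x where "x \<in> E1" "Dc c x > 0"
        using \<open>E1 \<in> hit (Dc c)\<close> by (auto simp: hit_def)
      then show ?thesis
        using cS(2) E1(1) eff[of c] egg[OF E1(1)] unfolding DcS[of c]
        by (intro egg_gaining_chips[OF assms(1), of E1 "U c" "Dc (Suc c)" x])
           (auto simp: hit_def not_less)
    qed
    have "P (Dc c)"
      using eff f0 fire_script_add by (force simp: P_def Dc_def)
    then have "card (hit (Dc c)) \<le> card (hit D0)"
      by (rule max)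
    moreover have "finite (hit (Dc c))"
      using finS by (simp add: hit_def)
    ultimately have "\<not> hit D0 \<subset> hit (Dc c)"
      by (meson psubset_card_mono not_less)
    \<comment> \<open>If every egg met by \<open>D0\<close> were also met by \<open>Dc c\<close>,
      the extra egg \<open>E1\<close> would make the inclusion proper, against the maximality of
      \<open>D0\<close>.\<close>
    then obtain E2 where E2: "E2 \<in> hit D0" "E2 \<notin> hit (Dc c)"
      using \<open>E1 \<in> hit (Dc c)\<close> E1 by blast
    \<comment> \<open>The firing of \<open>U c\<close> need not be the one that empties
      \<open>E2\<close>; an earlier firing, of some \<open>U i\<close> with i \<ge> c, may do so.
      This is enough because \<open>U i\<close> is contained in \<open>U c\<close>.\<close>
    have "\<exists>i\<ge>c. E2 \<notin> hit (Dc i) \<and> E2 \<in> hit (Dc (Suc i))"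
    proof (rule ccontr)
      assume no: "\<not> ?thesis"
      have "E2 \<notin> hit (Dc M)"
        using cS(1)[THEN Suc_leD]
        by (induction M rule: dec_induct) (use no E2(2) in auto)
      then show False
        using E2 DcM by simp
    qed
    then obtain i where i: "i \<ge> c" "E2 \<notin> hit (Dc i)" "E2 \<in> hit (Dc (Suc i))" by blast
    have E2S: "E2 \<in> S"
      using E2 by (simp add: hit_def)
    obtain x where x: "x \<in> E2" "Dc (Suc i) x > 0"
      using i(3) by (auto simp: hit_def)
    have unhit: "Dc i y \<le> 0" if "y \<in> E2" for y
      using i(2) E2S that by (auto simp: hit_def not_less)
    have "E2 \<subseteq> U i"
      by (rule egg_losing_chips[OF assms(1) egg(1,3)[OF E2S] eff[of "Suc i"] x unhit[unfolded DcS[of i]]])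
    then have E2U: "E2 \<subseteq> U c"
      using i(1) by (auto simp: U_def)
    have "egg_cut_number G S \<le> enat (cut_size G (U c))"
      unfolding egg_cut_number_def
    proof (rule INF_lower, intro CollectI conjI bexI)
      show "U c \<subseteq> verts G" by (auto simp: U_def)
      show "E1 \<subseteq> verts G - U c" using E1U egg(1)[OF E1(1)] by blast
    qed (fact E2U E1(1) E2S)+
    moreover have "int (cut_size G (U c)) \<le> degree G (Dc (Suc c))"
      using eff[of c] eff[of "Suc c"] unfolding DcS[of c]
      by (intro fire_set_cut_size_le assms(1)) (auto simp: U_def)
    then have "enat (cut_size G (U c)) \<le> enat k"
      using deg by (simp add: Dc_def)
    ultimately have "egg_cut_number G S \<le> enat k"
      by (rule order_trans)
    then show ?thesis
      by (simp add: scramble_order_def min.coboundedI2)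
  qed
qed

text \<open>One chip on every vertex gives a divisor of positive rank, so the \<open>LEAST\<close>
  in \<open>gonality\<close> is taken over a nonempty set.\<close>

lemma gonality_attained:
  assumes "multigraph G"
  shows "\<exists>D\<in>divisors G. positive_rank G D \<and> degree G D = int (gonality G)"
proof -
  let ?D = "\<lambda>v. of_bool (v \<in> verts G) :: int"
  have "positive_rank G ?D"
    unfolding positive_rank_def div_equiv_def effective_def
    by (intro ballI exI conjI, rule equivclp_refl) auto
  moreover have "?D \<in> divisors G" "degree G ?D = int (card (verts G))"
    by (auto simp: divisors_def degree_def)
  ultimately have "\<exists>k. \<exists>D\<in>divisors G. positive_rank G D \<and> degree G D = int k"
    by blast
  then show ?thesis
    unfolding gonality_def by (rule LeastI_ex)
qed

lemma finite_scrambles: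
  assumes "multigraph G"
  shows "finite {S. scramble G S}"
proof (rule finite_subset)
  show "{S. scramble G S} \<subseteq> Pow (Pow (verts G))"
    by (auto simp: scramble_def)
  show "finite (Pow (Pow (verts G)))"
    using assms by (simp add: multigraph_def)
qed

lemma scramble_order_le_scramble_number:
  assumes "multigraph G" and "scramble G S"
  shows "scramble_order G S \<le> scramble_number G"
  unfolding scramble_number_def using finite_scrambles[OF assms(1)] assms(2) by (intro Max_ge) auto

lemma scramble_number_le_gonality:
  assumes "multigraph G"
  shows "scramble_number G \<le> enat (gonality G)"
proof -
  obtain D where D: "positive_rank G D" "degree G D = int (gonality G)"
    using gonality_attained[OF assms] by blast
  \<comment> \<open>The empty scramble makes the set of orders nonempty, as the characterization of
    \<open>Max\<close> requires.\<close>
  have "scramble G {}"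
    by (simp add: scramble_def)
  then show ?thesis
    unfolding scramble_number_def
    using finite_scrambles[OF assms] scramble_order_le_degree[OF assms _ D] by (subst Max_le_iff) auto
qed

section \<open>Cartesian products\<close>

lemma verts_cart_prod [simp]: "verts (G \<box> H) = verts G \<times> verts H"
  by (simp add: cart_prod_def)

text \<open>The weights live in a general semiring because the splitting is used both for firing,
  over the integers, and for cuts, over the naturals.\<close>

lemma sum_emult_cart_prod:
  fixes g :: "'a \<times> 'b \<Rightarrow> 'c::comm_semiring_1"
  assumes "multigraph G" and "multigraph H" and "u \<in> verts G" and "v \<in> verts H"
  shows "(\<Sum>x\<in>verts G \<times> verts H. of_nat (emult (G \<box> H) (u, v) x) * g x) =
    (\<Sum>w\<in>verts G. of_nat (emult G u w) * g (w, v)) +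
    (\<Sum>w\<in>verts H. of_nat (emult H v w) * g (u, w))"
proof -
  have fin: "finite (verts G)" "finite (verts H)" and irr: "emult G u u = 0" "emult H v v = 0"
    using assms by (auto simp: multigraph_def)
  have "(\<Sum>x\<in>verts G \<times> verts H. of_nat (emult (G \<box> H) (u, v) x) * g x) =
    (\<Sum>x\<in>verts G. \<Sum>y\<in>verts H. of_nat (emult (G \<box> H) (u, v) (x, y)) * g (x, y))"
    by (simp add: sum.cartesian_product)
  \<comment> \<open>The two conditional terms overlap only at (u, v) itself, where both vanish
    because there are no loops.\<close>
  also have "\<dots> = (\<Sum>x\<in>verts G. \<Sum>y\<in>verts H.
      (if y = v then of_nat (emult G u x) * g (x, y) else 0) +
      (if x = u then of_nat (emult H v y) * g (x, y) else 0))"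
    by (intro sum.cong refl) (use assms irr in \<open>auto simp: cart_prod_def\<close>)
  also have "\<dots> = (\<Sum>w\<in>verts G. of_nat (emult G u w) * g (w, v)) +
      (\<Sum>x\<in>verts G. \<Sum>y\<in>verts H. if x = u then of_nat (emult H v y) * g (x, y) else 0)"
    using fin assms(4) by (simp add: sum.distrib)
  also have "(\<Sum>x\<in>verts G. \<Sum>y\<in>verts H. if x = u then of_nat (emult H v y) * g (x, y) else 0) =
      (\<Sum>w\<in>verts H. of_nat (emult H v w) * g (u, w))"
    by (subst sum.swap) (use fin assms(3) in simp)
  finally show ?thesis .
qed

lemma fire_script_cart_prod:
  assumes "multigraph G" and "multigraph H" and "u \<in> verts G" and "v \<in> verts H"
  shows "fire_script (G \<box> H) f D (u, v) = D (u, v) +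
    (\<Sum>w\<in>verts G. int (emult G u w) * (f (w, v) - f (u, v))) +
    (\<Sum>w\<in>verts H. int (emult H v w) * (f (u, w) - f (u, v)))"
  using sum_emult_cart_prod[OF assms, of "\<lambda>x. f x - f (u, v)"] by (simp add: fire_script_def)

section \<open>Upper bounds for the gonality of a product\<close>

lemma gonality_le:
  assumes "D \<in> divisors G" and "positive_rank G D" and "degree G D = int k"
  shows "gonality G \<le> k"
  unfolding gonality_def by (rule Least_le) (use assms in blast)

text \<open>A script that depends only on the first coordinate moves nothing along the edges of H,
  so all copies of G are fired in parallel and each behaves like G alone.\<close>

lemma gonality_cart_prod_le_left:
  assumes G: "multigraph G" and H: "multigraph H"
  shows "gonality (G \<box> H) \<le> gonality G * card (verts H)"
proof -
  obtain D where D: "positive_rank G D" "degree G D = int (gonality G)"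
    using gonality_attained[OF G] by blast
  define D' where "D' x = (if x \<in> verts G \<times> verts H then D (fst x) else 0)" for x :: "'a \<times> 'b"
  have fire: "fire_script (G \<box> H) (\<lambda>x. f (fst x)) D' (u, v) = fire_script G f D u"
    if "u \<in> verts G" "v \<in> verts H" for f u v
    using that by (simp add: fire_script_cart_prod[OF G H] D'_def) (simp add: fire_script_def)
  have "positive_rank (G \<box> H) D'"
    unfolding positive_rank_iff_fire_script[OF multigraph_cart_prod[OF G H]]
  proof
    fix x assume "x \<in> verts (G \<box> H)"
    then obtain u v where x: "x = (u, v)" "u \<in> verts G" "v \<in> verts H" by auto
    then obtain f where "effective G (fire_script G f D)" "fire_script G f D u > 0"
      using D(1) positive_rank_iff_fire_script[OF G] by blast
    then show "\<exists>f. effective (G \<box> H) (fire_script (G \<box> H) f D') \<and> fire_script (G \<box> H) f D' x > 0"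
      using x fire by (intro exI[of _ "\<lambda>x. f (fst x)"]) (auto simp: effective_def)
  qed
  moreover have "degree (G \<box> H) D' = int (gonality G * card (verts H))"
  proof -
    have "degree (G \<box> H) D' = (\<Sum>u\<in>verts G. \<Sum>v\<in>verts H. D u)"
      unfolding sum.cartesian_product degree_def by (rule sum.cong) (auto simp: D'_def)
    then show ?thesis
      using D(2) by (simp add: degree_def flip: sum_distrib_left sum_distrib_right)
  qed
  ultimately show ?thesis
    by (intro gonality_le[of D']) (auto simp: D'_def divisors_def)
qed

lemma gonality_cart_prod_le_right:
  assumes G: "multigraph G" and H: "multigraph H"
  shows "gonality (G \<box> H) \<le> card (verts G) * gonality H"
proof -
  obtain D where D: "positive_rank H D" "degree H D = int (gonality H)"
    using gonality_attained[OF H] by blast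
  define D' where "D' x = (if x \<in> verts G \<times> verts H then D (snd x) else 0)" for x :: "'a \<times> 'b"
  have fire: "fire_script (G \<box> H) (\<lambda>x. f (snd x)) D' (u, v) = fire_script H f D v"
    if "u \<in> verts G" "v \<in> verts H" for f u v
    using that by (simp add: fire_script_cart_prod[OF G H] D'_def) (simp add: fire_script_def)
  have "positive_rank (G \<box> H) D'"
    unfolding positive_rank_iff_fire_script[OF multigraph_cart_prod[OF G H]]
  proof
    fix x assume "x \<in> verts (G \<box> H)"
    then obtain u v where x: "x = (u, v)" "u \<in> verts G" "v \<in> verts H" by auto
    then obtain f where "effective H (fire_script H f D)" "fire_script H f D v > 0"
      using D(1) positive_rank_iff_fire_script[OF H] by blast
    then show "\<exists>f. effective (G \<box> H) (fire_script (G \<box> H) f D') \<and> fire_script (G \<box> H) f D' x > 0"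
      using x fire by (intro exI[of _ "\<lambda>x. f (snd x)"]) (auto simp: effective_def)
  qed
  moreover have "degree (G \<box> H) D' = int (card (verts G) * gonality H)"
  proof -
    have "degree (G \<box> H) D' = (\<Sum>u\<in>verts G. \<Sum>v\<in>verts H. D v)"
      unfolding sum.cartesian_product degree_def by (rule sum.cong) (auto simp: D'_def)
    then show ?thesis
      using D(2) by (simp add: degree_def)
  qed
  ultimately show ?thesis
    by (intro gonality_le[of D']) (auto simp: D'_def divisors_def)
qed

section \<open>Cuts\<close>

text \<open>With indicators in place of restricted ranges, the inner sum has the shape that
  \<open>sum_emult_cart_prod\<close> splits.\<close>

lemma cut_size_alt:
  assumes "multigraph G" and "A \<subseteq> verts G"
  shows "cut_size G A =
    (\<Sum>u\<in>verts G. of_bool (u \<in> A) * (\<Sum>v\<in>verts G. emult G u v * of_bool (v \<notin> A)))"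
proof -
  have fin: "finite (verts G)"
    using assms(1) by (simp add: multigraph_def)
  have "(\<Sum>v\<in>verts G. emult G u v * of_bool (v \<notin> A)) = (\<Sum>v\<in>verts G - A. emult G u v)" for u
    using fin by (intro sum.mono_neutral_cong_right) auto
  then show ?thesis
    unfolding cut_size_def using fin assms(2) by (intro sum.mono_neutral_cong_left) auto
qed

lemma cut_size_cart_prod:
  assumes G: "multigraph G" and H: "multigraph H" and A: "A \<subseteq> verts G \<times> verts H"
  shows "cut_size (G \<box> H) A =
    (\<Sum>u\<in>verts G. cut_size H {v. (u, v) \<in> A}) + (\<Sum>v\<in>verts H. cut_size G {u. (u, v) \<in> A})"
proof -
  have "cut_size (G \<box> H) A = (\<Sum>x\<in>verts G \<times> verts H. of_bool (x \<in> A) *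
      (\<Sum>y\<in>verts G \<times> verts H. emult (G \<box> H) x y * of_bool (y \<notin> A)))"
    using cut_size_alt[OF multigraph_cart_prod[OF G H]] A by simp
  also have "\<dots> = (\<Sum>u\<in>verts G. \<Sum>v\<in>verts H. of_bool ((u, v) \<in> A) *
      (\<Sum>y\<in>verts G \<times> verts H. emult (G \<box> H) (u, v) y * of_bool (y \<notin> A)))"
    unfolding sum.cartesian_product by (rule sum.cong) auto
  also have "\<dots> = (\<Sum>u\<in>verts G. \<Sum>v\<in>verts H. of_bool ((u, v) \<in> A) *
      ((\<Sum>w\<in>verts G. emult G u w * of_bool ((w, v) \<notin> A)) +
       (\<Sum>w\<in>verts H. emult H v w * of_bool ((u, w) \<notin> A))))"
    using sum_emult_cart_prod[OF G H, where g = "\<lambda>x. of_bool (x \<notin> A) :: nat"]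
    by (intro sum.cong refl arg_cong2[where f = "(*)"]) simp
  also have "\<dots> =
      (\<Sum>u\<in>verts G. \<Sum>v\<in>verts H. of_bool ((u, v) \<in> A) *
        (\<Sum>w\<in>verts H. emult H v w * of_bool ((u, w) \<notin> A))) +
      (\<Sum>v\<in>verts H. \<Sum>u\<in>verts G. of_bool ((u, v) \<in> A) *
        (\<Sum>w\<in>verts G. emult G u w * of_bool ((w, v) \<notin> A)))"
    by (subst (3) sum.swap) (simp only: distrib_left sum.distrib add.commute)
  also have "\<dots> =
      (\<Sum>u\<in>verts G. cut_size H {v. (u, v) \<in> A}) + (\<Sum>v\<in>verts H. cut_size G {u. (u, v) \<in> A})"
    by (intro arg_cong2[where f = "(+)"] sum.cong refl; subst cut_size_alt) (use G H A in auto)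
  finally show ?thesis .
qed

lemma edge_connectivity_le_cut_size:
  assumes G: "multigraph G" and X: "X \<subseteq> verts G" and x: "x \<in> X" and y: "y \<in> verts G - X"
  shows "edge_connectivity G \<le> cut_size G X"
proof -
  have fin: "finite (verts G)" and sym: "emult G u v = emult G v u" for u v
    using G by (auto simp: multigraph_def)
  define F where "F u v = (if (u \<in> X) = (v \<in> X) then 0 else emult G u v)" for u v
  \<comment> \<open>\<open>F\<close> consists of the edges across the cut. Ordered pairs count each
    of them once in either direction, and the halving in \<open>num_edges\<close> removes the factor
    2.\<close>
  have "(\<Sum>u\<in>verts G. \<Sum>v\<in>verts G. F u v) =
      (\<Sum>u\<in>verts G. \<Sum>v\<in>verts G. of_bool (u \<in> X) * (emult G u v * of_bool (v \<notin> X)) +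
        of_bool (v \<in> X) * (emult G v u * of_bool (u \<notin> X)))"
    by (intro sum.cong refl) (auto simp: F_def sym)
  also have "\<dots> = cut_size G X + (\<Sum>u\<in>verts G. \<Sum>v\<in>verts G.
        of_bool (v \<in> X) * (emult G v u * of_bool (u \<notin> X)))"
    unfolding cut_size_alt[OF G X] by (simp add: sum.distrib sum_distrib_left)
  also have "(\<Sum>u\<in>verts G. \<Sum>v\<in>verts G. of_bool (v \<in> X) * (emult G v u * of_bool (u \<notin> X))) =
      cut_size G X"
    unfolding cut_size_alt[OF G X] by (subst sum.swap) (simp add: sum_distrib_left)
  finally have "num_edges G F = cut_size G X"
    by (simp add: num_edges_def)
  moreover have "edge_subset G F"
    by (auto simp: edge_subset_def F_def sym)
  moreover have "\<not> graph_connected (delete_edges G F)"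
  proof
    assume "graph_connected (delete_edges G F)"
    then have "(\<lambda>u v. emult (delete_edges G F) u v > 0)\<^sup>*\<^sup>* x y"
      using x y X by (auto simp: graph_connected_def delete_edges_def)
    then have "y \<in> X"
    proof (induction rule: rtranclp_induct)
      case base
      show ?case by (rule x)
    next
      case (step a b)
      then show ?case
        by (auto simp: delete_edges_def F_def split: if_splits)
    qed
    with y show False by simp
  qed
  ultimately have "(LEAST k. \<exists>F. edge_subset G F \<and> num_edges G F = k \<and>
      \<not> graph_connected (delete_edges G F)) \<le> cut_size G X"
    by (intro Least_le) blast
  then show ?thesis
    by (simp add: edge_connectivity_def)
qed

lemma min_valence_le_cut_size_singleton:
  assumes "multigraph G" and "u \<in> verts G"
  shows "min_valence G \<le> cut_size G {u}"
proof -
  have fin: "finite (verts G)" and irr: "emult G u u = 0"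
    using assms by (auto simp: multigraph_def)
  have "cut_size G {u} = valence G u"
    using fin irr assms(2) by (simp add: cut_size_def valence_def sum.remove)
  then show ?thesis
    using fin assms(2) by (simp add: min_valence_def)
qed

lemma cut_size_Compl:
  assumes "multigraph G" and "A \<subseteq> verts G"
  shows "cut_size G (verts G - A) = cut_size G A"
proof -
  have dd: "verts G - (verts G - A) = A" and sym: "emult G u v = emult G v u" for u v
    using assms by (auto simp: multigraph_def)
  show ?thesis
    unfolding cut_size_def dd by (subst sum.swap) (simp add: sym)
qed

lemma vertex_connectivity_ge_2:
  assumes "multigraph G" and "vertex_connectivity G \<ge> 2"
  shows "card (verts G) \<ge> 3" and "\<And>u. u \<in> verts G \<Longrightarrow> graph_connected (induced G (verts G - {u}))"
proof -
  have fin: "finite (verts G)" and ne: "verts G \<noteq> {}"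
    using assms(1) by (auto simp: multigraph_def)
  have small: "graph_connected (induced G (verts G - S)) \<and> card (verts G - S) \<noteq> 1"
    if "S \<subseteq> verts G" "card S < 2" for S
  proof -
    have "card S < vertex_connectivity G"
      using that(2) assms(2) by simp
    from not_less_Least[OF this[unfolded vertex_connectivity_def]] that(1) show ?thesis by blast
  qed
  show "graph_connected (induced G (verts G - {u}))" if "u \<in> verts G" for u
    using small[of "{u}"] that by simp
  obtain u where "u \<in> verts G" using ne by blast
  \<comment> \<open>The one-vertex clause in the definition of vertex-connectivity is what excludes
    graphs with one or two vertices.\<close>
  then have "card (verts G) \<noteq> 0" "card (verts G) - 1 \<noteq> 1" "card (verts G) \<noteq> 1"
    using small[of "{}"] small[of "{u}"] fin by auto
  then show "card (verts G) \<ge> 3" by linarith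
qed

section \<open>The scramble of vertex-deleted copies of the first factor\<close>

text \<open>Whole copies of G as eggs could be hit by one vertex per copy. Leaving out each vertex
  in turn forces a second one, which is where the factor 2 in the hitting number comes from.\<close>

definition layer_scramble :: "'a mgraph \<Rightarrow> 'b mgraph \<Rightarrow> ('a \<times> 'b) set set" where
  "layer_scramble G H = {(verts G - {u}) \<times> {v} |u v. u \<in> verts G \<and> v \<in> verts H}"

lemma scramble_layer_scramble:
  assumes G: "multigraph G" and "vertex_connectivity G \<ge> 2"
  shows "scramble (G \<box> H) (layer_scramble G H)"
  unfolding scramble_def
proof
  fix E assume "E \<in> layer_scramble G H"
  then obtain u v where E: "E = (verts G - {u}) \<times> {v}" and u: "u \<in> verts G" and v: "v \<in> verts H"
    by (auto simp: layer_scramble_def)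
  have "verts G - {u} \<noteq> {}"
  proof
    assume "verts G - {u} = {}"
    then have "card (verts G) \<le> card {u}"
      by (intro card_mono) auto
    then show False
      using vertex_connectivity_ge_2(1)[OF assms] by simp
  qed
  moreover have "graph_connected (induced (G \<box> H) E)"
    unfolding graph_connected_def
  proof (intro ballI)
    fix p q assume "p \<in> verts (induced (G \<box> H) E)" "q \<in> verts (induced (G \<box> H) E)"
    then obtain a b where p: "p = (a, v)" "q = (b, v)" "a \<in> verts G - {u}" "b \<in> verts G - {u}"
      by (auto simp: E induced_def)
    then have "(\<lambda>x y. emult (induced G (verts G - {u})) x y > 0)\<^sup>*\<^sup>* a b"
      using vertex_connectivity_ge_2(2)[OF assms u] by (simp add: graph_connected_def induced_def)
    then have "(\<lambda>x y. emult (induced (G \<box> H) E) x y > 0)\<^sup>*\<^sup>* (a, v) (b, v)"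
    proof (induction rule: rtranclp_induct)
      case base
      show ?case by simp
    next
      case (step y z)
      \<comment> \<open>If the first coordinates agreed, \<open>cart_prod\<close> would read the
        multiplicity off \<open>H\<close> instead of \<open>G\<close>.\<close>
      from step(2) have "y \<noteq> z"
        using G by (auto simp: multigraph_def induced_def split: if_splits)
      moreover have "y \<in> verts G - {u}" "z \<in> verts G - {u}" "emult G y z > 0"
        using step(2) by (auto simp: induced_def split: if_splits)
      ultimately have "emult (induced (G \<box> H) E) (y, v) (z, v) > 0"
        using v by (auto simp: induced_def E cart_prod_def split: if_splits)
      with step(3) show ?case by (rule rtranclp.rtrancl_into_rtrancl)
    qed
    then show "(\<lambda>x y. emult (induced (G \<box> H) E) x y > 0)\<^sup>*\<^sup>* p q"
      using p by simp
  qed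
  ultimately show "E \<subseteq> verts (G \<box> H) \<and> E \<noteq> {} \<and> graph_connected (induced (G \<box> H) E)"
    using v by (auto simp: E)
qed

lemma hitting_number_layer_scramble:
  assumes G: "multigraph G" and H: "multigraph H" and \<kappa>: "vertex_connectivity G \<ge> 2"
  shows "2 * card (verts H) \<le> hitting_number (G \<box> H) (layer_scramble G H)"
proof -
  have fin: "finite (verts G)" "finite (verts H)" and ne: "verts G \<noteq> {}"
    using G H by (auto simp: multigraph_def)
  have "\<exists>T\<subseteq>verts (G \<box> H). card T = card (verts (G \<box> H)) \<and> (\<forall>E\<in>layer_scramble G H. T \<inter> E \<noteq> {})"
  proof (intro exI conjI ballI)
    fix E assume "E \<in> layer_scramble G H"
    then have "E \<subseteq> verts (G \<box> H)" "E \<noteq> {}"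
      using scramble_layer_scramble[OF G \<kappa>, of H] by (auto simp: scramble_def)
    then show "verts (G \<box> H) \<inter> E \<noteq> {}" by blast
  qed auto
  then have "\<exists>T\<subseteq>verts (G \<box> H). card T = hitting_number (G \<box> H) (layer_scramble G H) \<and>
      (\<forall>E\<in>layer_scramble G H. T \<inter> E \<noteq> {})"
    unfolding hitting_number_def by (rule LeastI)
  then obtain T where T: "T \<subseteq> verts G \<times> verts H"
    "card T = hitting_number (G \<box> H) (layer_scramble G H)"
    "\<And>E. E \<in> layer_scramble G H \<Longrightarrow> T \<inter> E \<noteq> {}" by auto
  have T3: "\<exists>x\<in>verts G. x \<noteq> u \<and> (x, v) \<in> T" if "u \<in> verts G" "v \<in> verts H" for u v
    using T(3)[of "(verts G - {u}) \<times> {v}"] that by (auto simp: layer_scramble_def)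
  have two: "2 \<le> card {x. (x, v) \<in> T}" if v: "v \<in> verts H" for v
  proof -
    \<comment> \<open>A hitting set has some vertex x in the copy over \<open>v\<close>; the egg
      that leaves out x then forces another one.\<close>
    obtain x where x: "x \<in> verts G" "(x, v) \<in> T"
      using T3[OF _ v] ne by blast
    obtain y where y: "y \<noteq> x" "(y, v) \<in> T"
      using T3[OF x(1) v] by blast
    have "finite {x. (x, v) \<in> T}"
      by (rule finite_subset[OF _ fin(1)]) (use T(1) in auto)
    then have "card {x, y} \<le> card {x. (x, v) \<in> T}"
      using x y by (intro card_mono) auto
    then show ?thesis using y(1) by simp
  qed
  have "card T = card (SIGMA v:verts H. {x. (x, v) \<in> T})"
    by (rule bij_betw_same_card[of prod.swap])
       (use T(1) in \<open>force simp: bij_betw_def inj_on_def image_iff\<close>)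
  also have "\<dots> = (\<Sum>v\<in>verts H. card {x. (x, v) \<in> T})"
    using fin(2) by (rule card_SigmaI) (auto intro!: finite_subset[OF _ fin(1)] dest: subsetD[OF T(1)])
  also have "\<dots> \<ge> (\<Sum>v\<in>verts H. 2)"
    using two by (rule sum_mono)
  finally show ?thesis
    using T(2) by simp
qed

text \<open>\<open>k1\<close> and \<open>k2\<close> are the outcomes with no and with two unsplit
  copies of H, arranged so that no subtraction of naturals occurs. Below, \<open>c\<close> measures
  the cut inside a copy of H, and \<open>r\<close> inside a copy of G.\<close>

lemma layer_cut_size:
  assumes G: "multigraph G" and H: "multigraph H" and "v \<noteq> v'"
    and A: "A \<subseteq> verts G \<times> verts H"
    and uv: "u \<in> verts G" "v \<in> verts H" "(verts G - {u}) \<times> {v} \<subseteq> A"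
    and uv': "u' \<in> verts G" "v' \<in> verts H" "(verts G - {u'}) \<times> {v'} \<inter> A = {}"
    and k1: "k \<le> card (verts G) * edge_connectivity H"
    and k2: "k + 2 * edge_connectivity H \<le> card (verts G) * edge_connectivity H + 2 * min_valence G"
  shows "k \<le> cut_size (G \<box> H) A"
proof -
  have fin: "finite (verts G)" "finite (verts H)"
    using G H by (auto simp: multigraph_def)
  define l where "l = edge_connectivity H"
  define d where "d = min_valence G"
  define c where "c x = cut_size H {y. (x, y) \<in> A}" for x
  define r where "r y = cut_size G {x. (x, y) \<in> A}" for y
  have cut: "cut_size (G \<box> H) A = sum c (verts G) + sum r (verts H)"
    unfolding c_def r_def by (rule cut_size_cart_prod[OF G H A])
  have split: "l \<le> c x" if "(x, v) \<in> A" "(x, v') \<notin> A" for x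
    unfolding l_def c_def
    by (rule edge_connectivity_le_cut_size[OF H, of _ v v']) (use A uv' that in auto)
  have "r v + r v' = sum r {v, v'}" using \<open>v \<noteq> v'\<close> by simp
  also have "\<dots> \<le> sum r (verts H)"
    using fin uv uv' by (intro sum_mono2) auto
  finally have rows: "r v + r v' \<le> sum r (verts H)" .
  \<comment> \<open>If the vertex left out by the egg is also missed by \<open>A\<close>, then
    \<open>A\<close> cuts this copy of G into \<open>{u}\<close> and the rest, and complementary
    sets have the same cut.\<close>
  have star: "d \<le> r v" if "(u, v) \<notin> A"
  proof -
    have "{x. (x, v) \<in> A} = verts G - {u}"
      using that A uv by auto
    then show ?thesis
      using min_valence_le_cut_size_singleton[OF G uv(1)] cut_size_Compl[OF G, of "{u}"] uv
      by (simp add: r_def d_def)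
  qed
  have star': "d \<le> r v'" if "(u', v') \<in> A"
  proof -
    have "{x. (x, v') \<in> A} = {u'}"
      using that A uv' by auto
    then show ?thesis
      using min_valence_le_cut_size_singleton[OF G uv'(1)] by (simp add: r_def d_def)
  qed
  \<comment> \<open>Over any x other than \<open>u\<close> and \<open>u'\<close> both eggs are
    present, so (x, v) is in \<open>A\<close> and (x, v') is not: these copies of H are certainly
    split.\<close>
  define N where "N = card (verts G - {u, u'}) * l"
  have cols: "N + sum c {u, u'} \<le> sum c (verts G)"
  proof -
    have "N = (\<Sum>x\<in>verts G - {u, u'}. l)" by (simp add: N_def)
    also have "\<dots> \<le> sum c (verts G - {u, u'})"
      by (rule sum_mono, rule split) (use uv uv' in auto)
    finally show ?thesis
      using sum.subset_diff[of "{u, u'}" "verts G" c] fin uv uv' by simp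
  qed
  have nl: "card (verts G) * l = N + card {u, u'} * l"
  proof -
    have "card (verts G) = card (verts G - {u, u'}) + card {u, u'}"
      using fin uv uv' card_mono[of "verts G" "{u, u'}"] by (subst card_Diff_subset) auto
    then show ?thesis by (simp add: N_def algebra_simps)
  qed
  show ?thesis
  proof (cases "u = u'")
    case True
    \<comment> \<open>Only one copy of H is in doubt. If it is not split, one star of G suffices,
      because (n-1)*l + d is the mean of the bounds in \<open>k1\<close> and
      \<open>k2\<close>.\<close>
    have "l \<le> c u \<or> d \<le> r v \<or> d \<le> r v'"
      using split star star' True by blast
    then show ?thesis
      using k1 k2 nl cols rows True unfolding cut l_def[symmetric] d_def[symmetric] by auto
  next
    case False
    \<comment> \<open>Now (u, v') is outside \<open>A\<close> and (u', v) is inside it in any case.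
      So a failure over \<open>u\<close> is charged to the copy at \<open>v\<close>, one over
      \<open>u'\<close> to the copy at \<open>v'\<close>, and no star is counted twice.\<close>
    have "l \<le> c u \<or> d \<le> r v"
      using split[of u] star False uv uv' by blast
    moreover have "l \<le> c u' \<or> d \<le> r v'"
      using split[of u'] star' False uv uv' by blast
    ultimately show ?thesis
      using k1 k2 nl cols rows False unfolding cut l_def[symmetric] d_def[symmetric] by auto
  qed
qed

text \<open>If \<open>H\<close> has one vertex, then \<open>\<lambda>(H) = 0\<close>, but there is no egg-cut either.\<close>

lemma scramble_number_cart_prod_ge:
  assumes G: "multigraph G" and H: "multigraph H" and \<kappa>: "vertex_connectivity G \<ge> 2"
    and k0: "k \<le> 2 * card (verts H)"
    and k1: "card (verts H) \<noteq> 1 \<Longrightarrow> k \<le> card (verts G) * edge_connectivity H"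
    and k2: "card (verts H) \<noteq> 1 \<Longrightarrow>
      k + 2 * edge_connectivity H \<le> card (verts G) * edge_connectivity H + 2 * min_valence G"
  shows "enat k \<le> scramble_number (G \<box> H)"
proof -
  let ?S = "layer_scramble G H"
  note n = vertex_connectivity_ge_2(1)[OF G \<kappa>]
  have "enat k \<le> enat (cut_size (G \<box> H) A)"
    if A: "A \<subseteq> verts (G \<box> H)" and E: "E \<in> ?S" "E \<subseteq> A" and E': "E' \<in> ?S" "E' \<subseteq> verts (G \<box> H) - A"
    for A E E'
  proof -
    obtain u v where uv: "u \<in> verts G" "v \<in> verts H" "E = (verts G - {u}) \<times> {v}"
      using E(1) by (auto simp: layer_scramble_def)
    obtain u' v' where uv': "u' \<in> verts G" "v' \<in> verts H" "E' = (verts G - {u'}) \<times> {v'}"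
      using E'(1) by (auto simp: layer_scramble_def)
    \<comment> \<open>A third vertex of G lies in both eggs if they belong to the same copy, which
      is impossible for eggs on opposite sides of a cut.\<close>
    have "\<not> verts G \<subseteq> {u, u'}"
    proof
      assume "verts G \<subseteq> {u, u'}"
      then have "card (verts G) \<le> card {u, u'}"
        by (intro card_mono) auto
      then show False
        using n card_insert_le_m1[of 2 "{u'}" u] by simp
    qed
    then have "v \<noteq> v'"
      using uv uv' E(2) E'(2) by blast
    then have "card (verts H) \<noteq> 1"
      using uv uv' by (auto simp: card_1_singleton_iff)
    then have "k \<le> cut_size (G \<box> H) A"
      using A E(2) E'(2) uv uv' k1 k2 by (intro layer_cut_size[OF G H \<open>v \<noteq> v'\<close> _ uv(1,2) _ uv'(1,2)]) auto
    then show ?thesis by simp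
  qed
  then have "enat k \<le> egg_cut_number (G \<box> H) ?S"
    unfolding egg_cut_number_def by (intro INF_greatest) blast
  moreover have "enat k \<le> enat (hitting_number (G \<box> H) ?S)"
    using hitting_number_layer_scramble[OF G H \<kappa>] k0 by simp
  ultimately have "enat k \<le> scramble_order (G \<box> H) ?S"
    by (simp add: scramble_order_def)
  also have "\<dots> \<le> scramble_number (G \<box> H)"
    by (intro scramble_order_le_scramble_number multigraph_cart_prod G H scramble_layer_scramble \<kappa>)
  finally show ?thesis .
qed

section \<open>Positivity of edge-connectivity and the two equalities\<close>

lemma edge_connectivity_pos:
  assumes G: "multigraph G" "graph_connected G" and "card (verts G) \<noteq> 1"
  shows "edge_connectivity G > 0"
proof -
  let ?P = "\<lambda>k. \<exists>F. edge_subset G F \<and> num_edges G F = k \<and> \<not> graph_connected (delete_edges G F)"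
  have fin: "finite (verts G)" and ne: "verts G \<noteq> {}"
    using G(1) by (auto simp: multigraph_def)
  have out: "emult G u v = 0" if "\<not> (u \<in> verts G \<and> v \<in> verts G)" for u v
    using G(1) that by (auto simp: multigraph_def)
  obtain x where x: "x \<in> verts G" using ne by blast
  obtain y where y: "y \<in> verts G" "y \<noteq> x"
  proof -
    have "verts G \<noteq> {x}"
      using assms(3) by auto
    with x show ?thesis using that by blast
  qed
  \<comment> \<open>Deleting all edges separates x from y, so the \<open>LEAST\<close> is taken over
    a nonempty set and its value is attained.\<close>
  have "\<not> (\<lambda>u v. emult (delete_edges G (emult G)) u v > 0)\<^sup>*\<^sup>* x y"
    using y by (auto simp: delete_edges_def elim: converse_rtranclpE)
  then have "\<not> graph_connected (delete_edges G (emult G))"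
    using x y unfolding graph_connected_def by (auto simp: delete_edges_def)
  moreover have "edge_subset G (emult G)"
    using G(1) by (auto simp: edge_subset_def multigraph_def)
  ultimately have "\<exists>k. ?P k" by blast
  then have "?P (LEAST k. ?P k)" by (rule LeastI_ex)
  moreover have "\<not> ?P 0"
  proof
    assume "?P 0"
    then obtain F where F: "edge_subset G F" "num_edges G F = 0" "\<not> graph_connected (delete_edges G F)"
      by blast
    have Fle: "F u v \<le> emult G u v" and Fsym: "F u v = F v u" for u v
      using F(1) by (auto simp: edge_subset_def)
    have "F u v = 0" for u v
    proof (rule ccontr)
      assume pos: "F u v \<noteq> 0"
      then have uv: "u \<in> verts G" "v \<in> verts G" "u \<noteq> v"
        using Fle[of u v] out[of u v] G(1) by (auto simp: multigraph_def)
      have row: "F a b \<le> (\<Sum>v\<in>verts G. F a v)" if "b \<in> verts G" for a b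
        using fin that by (intro member_le_sum) auto
      \<comment> \<open>Since \<open>num_edges\<close> rounds down, one positive entry of
        \<open>F\<close> would not contradict the value 0. Symmetry provides a second one in another
        row, so the double sum is at least 2.\<close>
      have "(\<Sum>a\<in>{u, v}. \<Sum>b\<in>verts G. F a b) \<le> (\<Sum>a\<in>verts G. \<Sum>b\<in>verts G. F a b)"
        using fin uv by (intro sum_mono2) auto
      then have "F u v + F v u \<le> (\<Sum>a\<in>verts G. \<Sum>b\<in>verts G. F a b)"
        using uv row[of v u] row[of u v] by simp
      then show False
        using pos F(2) Fsym[of u v] by (simp add: num_edges_def)
    qed
    then have "delete_edges G F = G"
      by (simp add: delete_edges_def)
    then show False
      using F(3) G(2) by simp
  qed
  ultimately show ?thesis
    unfolding edge_connectivity_def using assms(3) by (simp only: if_False) (rule gr0I, simp only:)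
qed

lemma scramble_number_eq_gonality:
  assumes "multigraph G" and "enat k \<le> scramble_number G" and "gonality G \<le> k"
  shows "scramble_number G = enat (gonality G) \<and> gonality G = k"
proof -
  have "enat k \<le> enat (gonality G)"
    using assms(2) scramble_number_le_gonality[OF assms(1)] by (rule order_trans)
  then have "gonality G = k"
    using assms(3) by simp
  then show ?thesis
    using assms(2) scramble_number_le_gonality[OF assms(1)] by (simp add: antisym)
qed

theorem theorem5p7:
  fixes G :: "'a mgraph" and H :: "'b mgraph"
  assumes "multigraph G" and "multigraph H"
    and "graph_connected G" and "graph_connected H"
    and "vertex_connectivity G \<ge> 2"
  shows
    "(gonality G = 2
        \<and> real (card (verts H)) / real (edge_connectivity H) \<le> 1 / 2 * real (card (verts G))
        \<and> real (card (verts H)) \<le>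
            1 / 2 * real (card (verts G)) * real (edge_connectivity H)
              + (real (min_valence G) - real (edge_connectivity H))
      \<longrightarrow> scramble_number (G \<box> H) = enat (gonality (G \<box> H))
        \<and> gonality (G \<box> H) = 2 * card (verts H))
     \<and>
     (edge_connectivity H = gonality H
        \<and> 2 * real (card (verts H)) / real (edge_connectivity H) \<ge> real (card (verts G))
        \<and> edge_connectivity H \<le> min_valence G
      \<longrightarrow> scramble_number (G \<box> H) = enat (gonality (G \<box> H))
        \<and> gonality (G \<box> H) = card (verts G) * edge_connectivity H)"
proof (intro conjI impI)
  have GH: "multigraph (G \<box> H)"
    using assms by (intro multigraph_cart_prod)
  let ?n = "card (verts G)" and ?m = "card (verts H)"
  let ?l = "edge_connectivity H" and ?d = "min_valence G"
  {
    assume h: "gonality G = 2 \<and> real ?m / real ?l \<le> 1 / 2 * real ?n \<and>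
      real ?m \<le> 1 / 2 * real ?n * real ?l + (real ?d - real ?l)"
    have le: "gonality (G \<box> H) \<le> 2 * ?m"
      using gonality_cart_prod_le_left[OF assms(1,2)] h by simp
    have "2 * ?m \<le> ?n * ?l" if "?m \<noteq> 1"
    proof -
      \<comment> \<open>The quotient can be cleared only if \<lambda>(H) is positive, since division
        by 0 yields 0; a connected H with more than one vertex guarantees this.\<close>
      have "2 * real ?m \<le> real ?n * real ?l"
        using h edge_connectivity_pos[OF assms(2,4) that] by (simp add: field_simps)
      then have "real (2 * ?m) \<le> real (?n * ?l)" by simp
      then show ?thesis unfolding of_nat_le_iff .
    qed
    moreover have "2 * ?m + 2 * ?l \<le> ?n * ?l + 2 * ?d"
    proof -
      have "real (2 * ?m + 2 * ?l) \<le> real (?n * ?l + 2 * ?d)"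
        using h by simp
      then show ?thesis unfolding of_nat_le_iff .
    qed
    ultimately have "scramble_number (G \<box> H) = enat (gonality (G \<box> H)) \<and> gonality (G \<box> H) = 2 * ?m"
      by (intro scramble_number_eq_gonality GH le scramble_number_cart_prod_ge assms) auto
    then show "scramble_number (G \<box> H) = enat (gonality (G \<box> H))" "gonality (G \<box> H) = 2 * ?m"
      by auto
  next
    assume h: "?l = gonality H \<and> 2 * real ?m / real ?l \<ge> real ?n \<and> ?l \<le> ?d"
    have le: "gonality (G \<box> H) \<le> ?n * ?l"
      using gonality_cart_prod_le_right[OF assms(1,2)] h by simp
    \<comment> \<open>For \<lambda>(H) = 0 the quotient is 0 by convention and cannot be cleared,
      but then the left side is 0 as well.\<close>
    have "?n * ?l \<le> 2 * ?m"
    proof (cases "?l = 0")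
      case False
      have "real ?n \<le> 2 * real ?m / real ?l"
        using h by blast
      then have "real (?n * ?l) \<le> real (2 * ?m)"
        using False by (simp only: pos_le_divide_eq of_nat_0_less_iff neq0_conv) simp
      then show ?thesis unfolding of_nat_le_iff .
    qed simp
    then have "scramble_number (G \<box> H) = enat (gonality (G \<box> H)) \<and> gonality (G \<box> H) = ?n * ?l"
      using h by (intro scramble_number_eq_gonality GH le scramble_number_cart_prod_ge assms) auto
    then show "scramble_number (G \<box> H) = enat (gonality (G \<box> H))" "gonality (G \<box> H) = ?n * ?l"
      by auto
  }
qed

end
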